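(* In the stationary case $g^t\equiv g$, assume that $g\in G$ and that the kernel $K$ is a bounded Borel density with $\int_X K(y)\,dy=1$, $\sup_{y\in X} K(y)\le\overline K$, and $A=\int_{\mathbb{R}^r}\|y\|^{\nu}K(y)\,dy<+\infty$. Let $\{z^t\}$ be the sequence of SQG-estimates at $x\in X$ with constant adjustment and window parameters $\rho_t\equiv\rho$, $0<\rho\le1/2$, $\theta_t\equiv\theta>0$. Then at any point $x$ where $g$ is globally Hölder continuous (with constants $H=H(x)$, $\nu=\nu(x)>0$), for every $t\ge0$ $$(z^{t+1}-g(x))^2\le 2\overline gAH\theta^{\nu}+\overline g^{2}\rho+\overline K^{2}\rho\theta^{-2r}+(1-2\rho)^t(z^0-g(x))^2+\zeta_t,$$ where the stochastic term $\zeta_t$ has zero mean $\mathbf{E}\zeta_t=0$ and variance $D\zeta_t\le2\rho\,\overline g^{3}(\overline g+\overline K\theta^{-r})$.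
   Context: Let $X\subseteq\mathbb{R}^r$. $G$ is the class of functions $g$ on $X$ with $0\le\underline g(x)\le g(x)\le\overline g(x)\le\overline g$ for all $x\in X$, where $\underline g(\cdot),\overline g(\cdot)$ are given functions and $\overline g$ is a finite constant. $g$ is a probability density on $X$; the observations $\overline x_0,\overline x_1,\dots$ are i.i.d. random vectors with density $g$ on a probability space $(\Omega,\Sigma,P)$. $K\ge0$ is a kernel. Global Hölder continuity at $x$: there are $H=H(x)$ and $\nu=\nu(x)>0$ such that $|g(x)-g(y)|\le H\|x-y\|^{\nu}$ for all $y\in X$. SQG-estimates at $x$: given $z^0\in[\underline g(x),\overline g(x)]$, adjustment coefficients $\rho_t$ and window parameters $\theta_t$, $$z^{t+1}=\min\{\overline g(x),\max\{\underline g(x),\,z^t-\rho_t\xi_t\}\},\qquad \xi_t=z^t-\frac1{\theta_t^r}K\Big(\frac{\overline x_t-x}{\theta_t}\Big),\quad t=0,1,\dots$$ $\mathbf{E}$ and $D$ denote expectation and variance.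
   Formalization: Adds the hypothesis that the scaled kernel θ^{-r}K((y−x)/θ) also integrates to 1 over X (automatic for X=R^r); without it the claim fails, e.g. X=[0,1], g=1, K=1_{[0,1]}, x=1, θ=1, ρ<1/2. *)

theory Defs
  imports "HOL-Probability.Probability"
begin

definition bounded_class ::
  "(real ^ 'r) set \<Rightarrow> (real ^ 'r \<Rightarrow> real) \<Rightarrow> (real ^ 'r \<Rightarrow> real) \<Rightarrow> real \<Rightarrow> (real ^ 'r \<Rightarrow> real) set" where
  "bounded_class X glo gup gbar =
     {g. \<forall>x\<in>X. 0 \<le> glo x \<and> glo x \<le> g x \<and> g x \<le> gup x \<and> gup x \<le> gbar}"

definition holder_at ::
  "(real ^ 'r) set \<Rightarrow> (real ^ 'r \<Rightarrow> real) \<Rightarrow> real ^ 'r \<Rightarrow> real \<Rightarrow> real \<Rightarrow> bool" where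
  "holder_at X g x H \<nu> \<longleftrightarrow> \<nu> > 0 \<and> (\<forall>y\<in>X. \<bar>g x - g y\<bar> \<le> H * norm (x - y) powr \<nu>)"

definition scaled_kernel ::
  "(real ^ 'r \<Rightarrow> real) \<Rightarrow> real \<Rightarrow> real ^ 'r \<Rightarrow> real ^ 'r \<Rightarrow> real" where
  "scaled_kernel K \<theta> x y = (1 / \<theta> ^ CARD('r)) * K ((1 / \<theta>) *\<^sub>R (y - x))"

text \<open>The estimates along one realisation \<open>obs\<close> of the observations.\<close>

primrec sqg ::
  "(real ^ 'r \<Rightarrow> real) \<Rightarrow> (real ^ 'r \<Rightarrow> real) \<Rightarrow> (real ^ 'r \<Rightarrow> real) \<Rightarrow> (nat \<Rightarrow> real) \<Rightarrow> (nat \<Rightarrow> real)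
     \<Rightarrow> real ^ 'r \<Rightarrow> real \<Rightarrow> (nat \<Rightarrow> real ^ 'r) \<Rightarrow> nat \<Rightarrow> real" where
  "sqg K glo gup \<rho> \<theta> x z0 obs 0 = z0"
| "sqg K glo gup \<rho> \<theta> x z0 obs (Suc t) =
     (let z = sqg K glo gup \<rho> \<theta> x z0 obs t;
          \<xi> = z - scaled_kernel K (\<theta> t) x (obs t)
      in min (gup x) (max (glo x) (z - \<rho> t * \<xi>)))"

end

theory Submission
  imports Defs
begin

text \<open>
  Projecting onto the admissible interval does not increase the distance to \<open>g x\<close>, so with
  \<open>k\<^sub>t\<close> the kernel value at step \<open>t\<close>, \<open>m\<close> its mean and \<open>\<Delta>\<^sub>t = z\<^sub>t - g x\<close> one has
  \<open>\<Delta>\<^sub>t\<^sub>+\<^sub>1\<^sup>2 \<le> (1 - 2\<rho>) \<Delta>\<^sub>t\<^sup>2 + 2\<rho> (k\<^sub>t - m) \<Delta>\<^sub>t + 2\<rho> (m - g x) \<Delta>\<^sub>t + \<rho>\<^sup>2 (z\<^sub>t - k\<^sub>t)\<^sup>2\<close>.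
  The last two terms are bounded by the Hoelder bias and the size of the kernel, and iterating
  the recursion sums them up to a constant. The second term is a martingale difference, since
  \<open>\<Delta>\<^sub>t\<close> depends on the past observations only; hence its geometrically weighted sums have mean
  zero, and the recursion for their second moments preserves the bound \<open>2\<rho> B\<^sup>2 v\<close>, where
  \<open>\<bar>\<Delta>\<^sub>t\<bar> \<le> B\<close> and \<open>v\<close> bounds the variance of \<open>k\<^sub>t\<close>.
\<close>

section \<open>The error recursion along one realisation\<close>

text \<open>In closed form this is the sum over \<open>s < t\<close> of
  \<open>2 * \<rho> * (1 - 2 * \<rho>) ^ (t - 1 - s) * a s\<close>, an exponentially weighted
  average whose weights add up to \<open>1 - (1 - 2 * \<rho>) ^ t\<close>.\<close>

primrec smoothed :: "real \<Rightarrow> (nat \<Rightarrow> real) \<Rightarrow> nat \<Rightarrow> real" where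
  "smoothed \<rho> a 0 = 0"
| "smoothed \<rho> a (Suc t) = (1 - 2 * \<rho>) * smoothed \<rho> a t + 2 * \<rho> * a t"

lemma smoothed_cong:
  assumes "\<And>s. s < t \<Longrightarrow> a s = b s"
  shows "smoothed \<rho> a t = smoothed \<rho> b t"
  using assms by (induction t) auto

text \<open>For \<open>0 \<le> 2 * \<rho> \<le> 1\<close> each step is a convex combination of the
  old value and \<open>a t\<close>, so it stays in \<open>[-B, B]\<close>.\<close>

lemma abs_smoothed_le:
  assumes rho: "0 \<le> \<rho>" "\<rho> \<le> 1/2" and a: "\<And>s. \<bar>a s\<bar> \<le> B"
  shows "\<bar>smoothed \<rho> a t\<bar> \<le> B"
proof (induction t)
  case 0
  show ?case using a[of 0] by simp
next
  case (Suc t)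
  have "\<bar>smoothed \<rho> a (Suc t)\<bar> \<le> (1 - 2 * \<rho>) * \<bar>smoothed \<rho> a t\<bar> + 2 * \<rho> * \<bar>a t\<bar>"
    using rho abs_triangle_ineq[of "(1 - 2 * \<rho>) * smoothed \<rho> a t" "2 * \<rho> * a t"]
    by (simp add: abs_mult)
  also have "\<dots> \<le> (1 - 2 * \<rho>) * B + 2 * \<rho> * B"
    using rho Suc a[of t] by (intro add_mono mult_left_mono) auto
  finally show ?case by (simp add: algebra_simps)
qed

lemma sqg_cong:
  assumes "\<And>s. s < t \<Longrightarrow> y s = y' s"
  shows "sqg K glo gup \<rho> \<theta> x z0 y t = sqg K glo gup \<rho> \<theta> x z0 y' t"
  using assms by (induction t) (auto simp: Let_def)

lemma sqg_in_range:
  assumes "z0 \<in> {glo x..gup x}"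
  shows "sqg K glo gup \<rho> \<theta> x z0 y t \<in> {glo x..gup x}"
proof (cases t)
  case (Suc s)
  then show ?thesis using assms by (auto simp: Let_def)
qed (use assms in simp)

text \<open>Projection onto an interval is nonexpansive and fixes the point \<open>c\<close> of that
  interval.\<close>

lemma clamp_dist_le:
  fixes c z :: real
  assumes "c \<in> {a..b}"
  shows "(min b (max a z) - c)\<^sup>2 \<le> (z - c)\<^sup>2"
  using assms by (intro abs_le_square_iff[THEN iffD1]) (auto simp: min_def max_def)

lemma gradient_step_bound:
  fixes z k c m \<rho> :: real
  assumes rho: "0 \<le> \<rho>" and z: "z \<in> {0..B}" and c: "c \<in> {0..B}"
    and k: "k \<in> {0..kmax}" and m: "\<bar>m - c\<bar> \<le> b"
  shows "(z - \<rho> * (z - k) - c)\<^sup>2 \<le> (1 - 2 * \<rho>) * (z - c)\<^sup>2 + 2 * \<rho> * ((k - m) * (z - c))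
    + 2 * \<rho> * (B * b) + \<rho>\<^sup>2 * (B\<^sup>2 + kmax\<^sup>2)"
proof -
  have "(m - c) * (z - c) \<le> \<bar>m - c\<bar> * \<bar>z - c\<bar>"
    by (metis abs_ge_self abs_mult)
  also have "\<dots> \<le> b * B"
    using m z c by (intro mult_mono) auto
  finally have bias: "2 * \<rho> * ((m - c) * (z - c)) \<le> 2 * \<rho> * (B * b)"
    using rho by (intro mult_left_mono) (auto simp: mult.commute)
  \<comment> \<open>The cross term \<open>-2 * z * k\<close> is dropped because \<open>z\<close> and
    \<open>k\<close> are both nonnegative; this avoids a factor 2.\<close>
  have "(z - k)\<^sup>2 \<le> z\<^sup>2 + k\<^sup>2"
    using mult_nonneg_nonneg[of z k] z k by (simp add: power2_diff)
  also have "\<dots> \<le> B\<^sup>2 + kmax\<^sup>2"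
    using z k by (intro add_mono power_mono) auto
  finally have "\<rho>\<^sup>2 * (z - k)\<^sup>2 \<le> \<rho>\<^sup>2 * (B\<^sup>2 + kmax\<^sup>2)"
    by (intro mult_left_mono) auto
  moreover have "(z - \<rho> * (z - k) - c)\<^sup>2 = (1 - 2 * \<rho>) * (z - c)\<^sup>2 + 2 * \<rho> * ((k - m) * (z - c))
      + 2 * \<rho> * ((m - c) * (z - c)) + \<rho>\<^sup>2 * (z - k)\<^sup>2"
    by (simp add: power2_eq_square algebra_simps)
  ultimately show ?thesis using bias by linarith
qed

text \<open>Induction with the one-step bound. The constant
  \<open>B * b + \<rho> / 2 * (B\<^sup>2 + kmax\<^sup>2)\<close> is the fixed point of the affine
  recursion \<open>C \<mapsto> (1 - 2 * \<rho>) * C + 2 * \<rho> * (B * b) + \<rho>\<^sup>2 *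
  (B\<^sup>2 + kmax\<^sup>2)\<close>, so it reproduces itself at every step.\<close>

lemma sqg_error_le:
  fixes K glo gup :: "real ^ 'r \<Rightarrow> real"
  assumes rho: "0 \<le> \<rho>" "\<rho> \<le> 1/2"
    and range: "0 \<le> glo x" "gup x \<le> B" and z0: "z0 \<in> {glo x..gup x}" and c: "c \<in> {glo x..gup x}"
    and k: "\<And>s. scaled_kernel K \<theta> x (y s) \<in> {0..kmax}" and m: "\<bar>m - c\<bar> \<le> b"
  defines "z \<equiv> sqg K glo gup (\<lambda>_. \<rho>) (\<lambda>_. \<theta>) x z0 y"
  shows "(z t - c)\<^sup>2 \<le> B * b + \<rho> / 2 * (B\<^sup>2 + kmax\<^sup>2) + (1 - 2 * \<rho>) ^ t * (z0 - c)\<^sup>2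
    + smoothed \<rho> (\<lambda>s. (scaled_kernel K \<theta> x (y s) - m) * (z s - c)) t" (is "_ \<le> ?C + _ + ?W t")
proof (induction t)
  case 0
  have "0 \<le> B" "0 \<le> b" using range z0 m by auto
  then show ?case using rho by (simp add: z_def)
next
  case (Suc t)
  let ?k = "scaled_kernel K \<theta> x (y t)"
  have zt: "z t \<in> {glo x..gup x}"
    unfolding z_def by (rule sqg_in_range) (rule z0)
  have "(z (Suc t) - c)\<^sup>2 \<le> (z t - \<rho> * (z t - ?k) - c)\<^sup>2"
    using clamp_dist_le[OF c] by (simp add: z_def Let_def)
  also have "\<dots> \<le> (1 - 2 * \<rho>) * (z t - c)\<^sup>2 + 2 * \<rho> * ((?k - m) * (z t - c))
      + 2 * \<rho> * (B * b) + \<rho>\<^sup>2 * (B\<^sup>2 + kmax\<^sup>2)"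
    using zt c range by (intro gradient_step_bound rho k m) auto
  also have "(1 - 2 * \<rho>) * (z t - c)\<^sup>2
      \<le> (1 - 2 * \<rho>) * (?C + (1 - 2 * \<rho>) ^ t * (z0 - c)\<^sup>2 + ?W t)"
    using Suc rho by (intro mult_left_mono) auto
  finally have "(z (Suc t) - c)\<^sup>2 \<le> (1 - 2 * \<rho>) * (?C + (1 - 2 * \<rho>) ^ t * (z0 - c)\<^sup>2 + ?W t)
      + 2 * \<rho> * ((?k - m) * (z t - c)) + 2 * \<rho> * (B * b) + \<rho>\<^sup>2 * (B\<^sup>2 + kmax\<^sup>2)"
    by simp
  moreover have "(1 - 2 * \<rho>) * ?C + 2 * \<rho> * (B * b) + \<rho>\<^sup>2 * (B\<^sup>2 + kmax\<^sup>2) = ?C"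
    by (simp add: field_simps power2_eq_square)
  ultimately show ?case
    unfolding smoothed.simps power_Suc by (simp only: distrib_left mult.assoc)
qed

section \<open>Measurability in the observed sequence\<close>

lemma borel_measurable_scaled_kernel [measurable]:
  assumes [measurable]: "K \<in> borel_measurable borel"
  shows "scaled_kernel K \<theta> x \<in> borel_measurable borel"
  unfolding scaled_kernel_def by measurable

text \<open>The product space over \<open>{..<t}\<close> stays fixed while \<open>s\<close> grows,
  because the smoothed sum at time \<open>t\<close> combines the estimates of all earlier times on
  one space.\<close>

lemma borel_measurable_sqg:
  assumes [measurable]: "K \<in> borel_measurable borel" and "s \<le> t"
  shows "(\<lambda>y. sqg K glo gup \<rho> \<theta> x z0 y s) \<in> borel_measurable (PiM {..<t} (\<lambda>_. borel))"
  using \<open>s \<le> t\<close>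
proof (induction s)
  case (Suc s)
  then have [measurable]: "(\<lambda>y. sqg K glo gup \<rho> \<theta> x z0 y s) \<in> borel_measurable (PiM {..<t} (\<lambda>_. borel))"
      "(\<lambda>y. y s) \<in> (PiM {..<t} (\<lambda>_. borel)) \<rightarrow>\<^sub>M borel"
    by simp_all
  show ?case by (simp add: Let_def)
qed simp

lemma borel_measurable_smoothed:
  assumes "\<And>s. s < t \<Longrightarrow> (\<lambda>w. a w s) \<in> borel_measurable N"
  shows "(\<lambda>w. smoothed \<rho> (a w) t) \<in> borel_measurable N"
  using assms
proof (induction t)
  case (Suc t)
  then have [measurable]: "(\<lambda>w. smoothed \<rho> (a w) t) \<in> borel_measurable N"
    "(\<lambda>w. a w t) \<in> borel_measurable N" by simp_all
  show ?case by simp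
qed simp

section \<open>Moments of the stochastic term\<close>

text \<open>The coordinate blocks \<open>{..<t}\<close> and \<open>{t}\<close> are disjoint, hence
  independent. The elements of a product space are restricted functions; \<open>past\<close> allows
  \<open>F\<close> to be evaluated on the whole sequence instead.\<close>

lemma (in prob_space) expectation_past_times_present:
  fixes Y :: "nat \<Rightarrow> 'a \<Rightarrow> 'b" and F :: "(nat \<Rightarrow> 'b) \<Rightarrow> real" and h :: "'b \<Rightarrow> real"
  assumes indep: "indep_vars (\<lambda>_. N) Y UNIV"
    and F: "F \<in> borel_measurable (PiM {..<t} (\<lambda>_. N))"
    and past: "\<And>y. F (restrict y {..<t}) = F y"
    and h: "h \<in> borel_measurable N"
    and int: "integrable M (\<lambda>w. F (\<lambda>s. Y s w))" "integrable M (\<lambda>w. h (Y t w))"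
  shows "expectation (\<lambda>w. F (\<lambda>s. Y s w) * h (Y t w))
      = expectation (\<lambda>w. F (\<lambda>s. Y s w)) * expectation (\<lambda>w. h (Y t w))"
proof -
  have "indep_var borel (F \<circ> (\<lambda>w. restrict (\<lambda>i. Y i w) {..<t}))
      borel ((\<lambda>f. h (f t)) \<circ> (\<lambda>w. restrict (\<lambda>i. Y i w) {t}))"
    by (rule indep_var_compose[OF indep_var_restrict[OF indep] F])
      (auto intro!: measurable_compose[OF _ h])
  then have "indep_var borel (\<lambda>w. F (\<lambda>s. Y s w)) borel (\<lambda>w. h (Y t w))"
    by (simp add: o_def past)
  from indep_var_lebesgue_integral[OF this int] show ?thesis .
qed

text \<open>\<open>e\<close> is the centred noise of one observation and \<open>D\<close> the
  predictable factor. Both act on observations, not on outcomes, so that dependence on the past is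
  invariance under restriction and independence of coordinate blocks applies.\<close>

locale martingale_noise = prob_space M for M :: "'a measure" +
  fixes N :: "'b measure" and Y :: "nat \<Rightarrow> 'a \<Rightarrow> 'b"
    and e :: "'b \<Rightarrow> real" and D :: "(nat \<Rightarrow> 'b) \<Rightarrow> nat \<Rightarrow> real" and B E v \<rho> :: real
  assumes indep: "indep_vars (\<lambda>_. N) Y UNIV"
    and D_measurable: "s \<le> t \<Longrightarrow> (\<lambda>y. D y s) \<in> borel_measurable (PiM {..<t} (\<lambda>_. N))"
    and D_past: "D (restrict y {..<t}) t = D y t"
    and D_bound: "\<bar>D y t\<bar> \<le> B"
    and e_measurable: "e \<in> borel_measurable N"
    and e_bound: "\<bar>e u\<bar> \<le> E"
    and e_mean: "expectation (\<lambda>w. e (Y t w)) = 0"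
    and e_second_moment: "expectation (\<lambda>w. (e (Y t w))\<^sup>2) \<le> v"
    and rho: "0 \<le> \<rho>" "\<rho> \<le> 1/2"
begin

definition noise :: "(nat \<Rightarrow> 'b) \<Rightarrow> nat \<Rightarrow> real" where
  "noise y = smoothed \<rho> (\<lambda>s. e (y s) * D y s)"

lemma noise_0: "noise y 0 = 0"
  and noise_Suc: "noise y (Suc t) = (1 - 2 * \<rho>) * noise y t + 2 * \<rho> * (D y t * e (y t))"
  by (simp_all add: noise_def mult_ac)

text \<open>\<open>D_past\<close> restricts to exactly \<open>{..<s}\<close>; agreement below
  \<open>s\<close> also covers restriction to a larger \<open>{..<t}\<close>, which is what the
  earlier terms of \<open>noise\<close> at time \<open>t\<close> require.\<close>

lemma D_cong: "(\<And>i. i < s \<Longrightarrow> y i = y' i) \<Longrightarrow> D y s = D y' s"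
  by (metis D_past lessThan_iff restrict_ext)

lemma noise_past: "noise (restrict y {..<t}) t = noise y t"
  unfolding noise_def by (intro smoothed_cong arg_cong2[where f="(*)"] D_cong) auto

lemma noise_measurable: "(\<lambda>y. noise y t) \<in> borel_measurable (PiM {..<t} (\<lambda>_. N))"
  unfolding noise_def using e_measurable
  by (intro borel_measurable_smoothed borel_measurable_times D_measurable)
    (auto intro: measurable_compose[OF measurable_component_singleton])

lemma noise_bound: "\<bar>noise y t\<bar> \<le> E * B"
  unfolding noise_def
proof (intro abs_smoothed_le rho)
  fix s
  show "\<bar>e (y s) * D y s\<bar> \<le> E * B"
    unfolding abs_mult using e_bound[of "y s"] D_bound[of y s] by (intro mult_mono) auto
qed

lemma Y_measurable [measurable]: "Y t \<in> M \<rightarrow>\<^sub>M N"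
  using indep by (simp add: indep_vars_def)

text \<open>The map to the restricted sequence is measurable into the product space, and
  \<open>past\<close> removes the restriction after composition with \<open>F\<close>.\<close>

lemma random_variable_past:
  fixes F :: "(nat \<Rightarrow> 'b) \<Rightarrow> real"
  assumes "F \<in> borel_measurable (PiM {..<t} (\<lambda>_. N))"
    and past: "\<And>y. F (restrict y {..<t}) = F y"
  shows "random_variable borel (\<lambda>w. F (\<lambda>s. Y s w))"
proof -
  have "(\<lambda>w. \<lambda>s\<in>{..<t}. Y s w) \<in> M \<rightarrow>\<^sub>M PiM {..<t} (\<lambda>_. N)"
    by (intro measurable_restrict) simp
  from measurable_compose[OF this assms(1)] show ?thesis by (simp add: past)
qed

lemma noise_random_variable [measurable]: "random_variable borel (\<lambda>w. noise (\<lambda>s. Y s w) t)"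
  by (rule random_variable_past[OF noise_measurable noise_past])

lemma D_random_variable [measurable]: "random_variable borel (\<lambda>w. D (\<lambda>s. Y s w) t)"
  by (rule random_variable_past[OF D_measurable[OF order_refl] D_past])

lemma e_random_variable [measurable]: "random_variable borel (\<lambda>w. e (Y t w))"
  by (rule measurable_compose[OF Y_measurable e_measurable])

lemma integrable_bounded:
  fixes f :: "'a \<Rightarrow> real"
  assumes "random_variable borel f" "\<And>w. \<bar>f w\<bar> \<le> C"
  shows "integrable M f"
  using assms by (intro integrable_const_bound[where B=C]) auto

lemma abs_power2_le: "\<bar>a\<bar> \<le> C \<Longrightarrow> \<bar>a\<^sup>2\<bar> \<le> C\<^sup>2" for a C :: real
  by (metis abs_power2 abs_ge_zero power2_abs power_mono)

lemma abs_mult_le: "\<bar>a\<bar> \<le> C \<Longrightarrow> \<bar>b\<bar> \<le> C' \<Longrightarrow> \<bar>a * b\<bar> \<le> C * C'" for a b C C' :: real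
  unfolding abs_mult by (intro mult_mono) auto

lemma integrable_noise: "integrable M (\<lambda>w. noise (\<lambda>s. Y s w) t)"
  by (rule integrable_bounded[OF _ noise_bound]) measurable

lemma integrable_noise_squared: "integrable M (\<lambda>w. (noise (\<lambda>s. Y s w) t)\<^sup>2)"
  by (rule integrable_bounded[OF _ abs_power2_le[OF noise_bound]]) measurable

lemma integrable_e: "integrable M (\<lambda>w. e (Y t w))"
  by (rule integrable_bounded[OF _ e_bound]) measurable

lemma integrable_e_squared: "integrable M (\<lambda>w. (e (Y t w))\<^sup>2)"
  by (rule integrable_bounded[OF _ abs_power2_le[OF e_bound]]) measurable

text \<open>The martingale difference property: the expectation factors by independence, and
  \<open>e\<close> has mean zero.\<close>

lemma expectation_past_times_e:
  assumes "F \<in> borel_measurable (PiM {..<t} (\<lambda>_. N))" "\<And>y. F (restrict y {..<t}) = F y"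
    and "\<And>y. \<bar>F y\<bar> \<le> C"
  shows "expectation (\<lambda>w. F (\<lambda>s. Y s w) * e (Y t w)) = 0"
  using expectation_past_times_present[OF indep assms(1,2) e_measurable _ integrable_e]
    integrable_bounded[OF random_variable_past[OF assms(1,2)] assms(3)]
  by (simp add: e_mean)

lemma expectation_noise: "expectation (\<lambda>w. noise (\<lambda>s. Y s w) t) = 0"
proof (induction t)
  case 0
  show ?case by (simp add: noise_0)
next
  case (Suc t)
  have "integrable M (\<lambda>w. D (\<lambda>s. Y s w) t * e (Y t w))"
    by (rule integrable_bounded[OF _ abs_mult_le[OF D_bound e_bound]]) measurable
  moreover have "expectation (\<lambda>w. D (\<lambda>s. Y s w) t * e (Y t w)) = 0"
    by (rule expectation_past_times_e[OF D_measurable D_past D_bound]) simp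
  ultimately show ?case
    by (simp add: noise_Suc integrable_noise Suc.IH)
qed

text \<open>On squaring the recursion the cross term vanishes in mean, since \<open>noise\<close>
  times \<open>D\<close> at time \<open>t\<close> depends on the past only. The second moments
  \<open>q t\<close> then satisfy \<open>q (t + 1) \<le> (1 - 2 * \<rho>)\<^sup>2 * q t + 4 *
  \<rho>\<^sup>2 * B\<^sup>2 * v\<close>, and the claimed bound is preserved because
  \<open>(1 - 2 * \<rho>)\<^sup>2 + 2 * \<rho> \<le> 1\<close> for
  \<open>0 \<le> \<rho> \<le> 1/2\<close>.\<close>

lemma expectation_noise_squared: "expectation (\<lambda>w. (noise (\<lambda>s. Y s w) t)\<^sup>2) \<le> 2 * \<rho> * B\<^sup>2 * v"
proof (induction t)
  case 0
  have "0 \<le> v"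
    by (rule order_trans[OF _ e_second_moment[of 0]]) simp
  then show ?case using rho by (simp add: noise_0)
next
  case (Suc t)
  let ?W = "\<lambda>w. noise (\<lambda>s. Y s w) t" and ?D = "\<lambda>w. D (\<lambda>s. Y s w) t" and ?e = "\<lambda>w. e (Y t w)"
  have v: "0 \<le> v"
    by (rule order_trans[OF _ e_second_moment[of 0]]) simp
  have "integrable M (\<lambda>w. (?W w * ?D w) * ?e w)"
    by (rule integrable_bounded[OF _ abs_mult_le[OF abs_mult_le[OF noise_bound D_bound] e_bound]])
      measurable
  moreover have "expectation (\<lambda>w. (?W w * ?D w) * ?e w) = 0"
    by (rule expectation_past_times_e[where F="\<lambda>y. noise y t * D y t",
          OF borel_measurable_times[OF noise_measurable D_measurable] _
          abs_mult_le[OF noise_bound D_bound]])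
      (simp_all add: noise_past D_past)
  moreover have De: "integrable M (\<lambda>w. (?D w)\<^sup>2 * (?e w)\<^sup>2)"
    by (rule integrable_bounded[OF _ abs_mult_le[OF abs_power2_le[OF D_bound]
            abs_power2_le[OF e_bound]]]) measurable
  moreover have "expectation (\<lambda>w. (?D w)\<^sup>2 * (?e w)\<^sup>2) \<le> expectation (\<lambda>w. B\<^sup>2 * (?e w)\<^sup>2)"
    using De integrable_e_squared[of t] abs_power2_le[OF D_bound]
    by (intro integral_mono mult_right_mono) auto
  then have "expectation (\<lambda>w. (?D w)\<^sup>2 * (?e w)\<^sup>2) \<le> B\<^sup>2 * v"
    using mult_left_mono[OF e_second_moment[of t], of "B\<^sup>2"] by simp
  then have "4 * \<rho>\<^sup>2 * expectation (\<lambda>w. (?D w)\<^sup>2 * (?e w)\<^sup>2) \<le> 4 * \<rho>\<^sup>2 * (B\<^sup>2 * v)"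
    by (intro mult_left_mono) auto
  moreover have "(noise (\<lambda>s. Y s w) (Suc t))\<^sup>2 = (1 - 2 * \<rho>)\<^sup>2 * (?W w)\<^sup>2
      + 4 * \<rho> * (1 - 2 * \<rho>) * ((?W w * ?D w) * ?e w) + 4 * \<rho>\<^sup>2 * ((?D w)\<^sup>2 * (?e w)\<^sup>2)" for w
    by (simp add: noise_Suc power2_eq_square algebra_simps)
  ultimately have "expectation (\<lambda>w. (noise (\<lambda>s. Y s w) (Suc t))\<^sup>2)
      \<le> (1 - 2 * \<rho>)\<^sup>2 * expectation (\<lambda>w. (?W w)\<^sup>2) + 4 * \<rho>\<^sup>2 * (B\<^sup>2 * v)"
    using integrable_noise_squared[of t] by simp
  also have "\<dots> \<le> (1 - 2 * \<rho>)\<^sup>2 * (2 * \<rho> * B\<^sup>2 * v) + 4 * \<rho>\<^sup>2 * (B\<^sup>2 * v)"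
    using Suc by (intro add_right_mono mult_left_mono) auto
  also have "\<dots> = ((1 - 2 * \<rho>)\<^sup>2 + 2 * \<rho>) * (2 * \<rho> * B\<^sup>2 * v)"
    by (simp add: power2_eq_square algebra_simps)
  also have "\<dots> \<le> 1 * (2 * \<rho> * B\<^sup>2 * v)"
  proof (intro mult_right_mono)
    have "\<rho> * (4 * \<rho>) \<le> \<rho> * 2" using rho by (intro mult_left_mono) auto
    then show "(1 - 2 * \<rho>)\<^sup>2 + 2 * \<rho> \<le> 1" by (simp add: power2_eq_square algebra_simps)
  qed (use v rho in auto)
  finally show ?case by simp
qed

end

section \<open>Bias and second moment of the kernel estimate\<close>

text \<open>Change of variables \<open>y = a + c *\<^sub>R u\<close>: Lebesgue measure is its image
  under this map, rescaled by the Jacobian \<open>c ^ DIM('a)\<close>.\<close>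

lemma
  fixes f :: "'a::euclidean_space \<Rightarrow> real"
  assumes [measurable]: "f \<in> borel_measurable borel" and c: "0 < c"
  shows integrable_lborel_affine_iff: "integrable lborel f \<longleftrightarrow> integrable lborel (\<lambda>u. f (a + c *\<^sub>R u))"
    and integral_lborel_affine: "(LINT y|lborel. f y) = c ^ DIM('a) * (LINT u|lborel. f (a + c *\<^sub>R u))"
proof -
  have eq: "lborel = density (distr lborel borel (\<lambda>u::'a. a + c *\<^sub>R u)) (\<lambda>_. ennreal (c ^ DIM('a)))"
    using c lborel_affine[of c a] by (simp add: ennreal_power)
  show "integrable lborel f \<longleftrightarrow> integrable lborel (\<lambda>u. f (a + c *\<^sub>R u))"
    using c by (subst eq) (simp add: integrable_density integrable_distr_eq)
  show "(LINT y|lborel. f y) = c ^ DIM('a) * (LINT u|lborel. f (a + c *\<^sub>R u))"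
    using c by (subst eq) (simp add: integral_density integral_distr)
qed

lemma AE_lborel_affine:
  assumes P: "{y. P y} \<in> sets borel" and c: "0 < c" and "AE u in lborel. P (a + c *\<^sub>R u)"
  shows "AE y in lborel. P (y :: 'a::euclidean_space)"
proof -
  have eq: "lborel = density (distr lborel borel (\<lambda>u::'a. a + c *\<^sub>R u)) (\<lambda>_. ennreal (c ^ DIM('a)))"
    using c lborel_affine[of c a] by (simp add: ennreal_power)
  show ?thesis
    using c assms by (subst eq) (simp add: AE_density AE_distr_iff)
qed

lemma scaled_kernel_affine:
  fixes K :: "real ^ 'r \<Rightarrow> real"
  shows "0 < \<theta> \<Longrightarrow> scaled_kernel K \<theta> x (x + \<theta> *\<^sub>R u) = K u / \<theta> ^ CARD('r)"
  by (simp add: scaled_kernel_def)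

text \<open>A function that is not integrable has integral 0 by convention, so total mass 1 already
  carries integrability.\<close>

lemma integrable_if_integral_eq_1: "(LINT y|N. f y) = (1::real) \<Longrightarrow> integrable N f"
  using not_integrable_integral_eq[of N f] by fastforce

text \<open>The whole mass of \<open>K\<close> sits on \<open>X\<close>, so \<open>K\<close>
  vanishes almost everywhere outside \<open>X\<close> and the supremum over \<open>X\<close> is an
  almost sure bound everywhere. This matters because the rescaled argument
  \<open>(y - x) / \<theta>\<close> may leave \<open>X\<close>.\<close>

lemma AE_kernel_le_SUP:
  fixes K :: "'a \<Rightarrow> real"
  assumes "K \<in> borel_measurable N" and nonneg: "\<And>y. 0 \<le> K y" and bdd: "bounded (range K)"
    and "(LINT y|N. K y) = 1" and "(LINT y:X|N. K y) = 1"
  shows "AE y in N. K y \<le> (SUP y\<in>X. K y)"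
proof -
  have int: "integrable N K" "integrable N (\<lambda>y. indicator X y * K y)"
    using assms(4,5) by (auto simp: set_lebesgue_integral_def intro: integrable_if_integral_eq_1)
  have "(LINT y|N. K y - indicator X y * K y) = 0"
    using assms(4,5) int by (simp add: set_lebesgue_integral_def)
  moreover have "integrable N (\<lambda>y. K y - indicator X y * K y)"
    using int by simp
  ultimately have ae: "AE y in N. K y - indicator X y * K y = 0"
    by (subst (asm) integral_nonneg_eq_0_iff_AE) (auto simp: nonneg indicator_def)
  have bdd': "bdd_above (K ` X)"
    using bdd bounded_imp_bdd_above by (meson bdd_above_mono image_mono subset_UNIV)
  \<comment> \<open>Needed at points outside \<open>X\<close>, where the kernel value is 0;
    \<open>X\<close> is nonempty since it carries mass 1.\<close>
  have sup: "0 \<le> (SUP y\<in>X. K y)"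
  proof -
    have "X \<noteq> {}" using assms(5) by (auto simp: set_lebesgue_integral_def)
    then show ?thesis using bdd' nonneg by (meson all_not_in_conv cSUP_upper2)
  qed
  from ae show ?thesis
  proof eventually_elim
    case (elim y)
    then show ?case
      using sup cSUP_upper[OF _ bdd', of y] by (cases "y \<in> X") auto
  qed
qed

text \<open>A nonzero integral over \<open>X\<close> excludes \<open>X \<subseteq> {x}\<close>,
  which is a null set; the Hoelder inequality at a second point of \<open>X\<close> then forces the
  sign of \<open>H\<close>.\<close>

lemma holder_at_const_nonneg:
  fixes X :: "(real ^ 'r) set"
  assumes "holder_at X g x H \<nu>" and "(LINT y:X|lborel. f y) \<noteq> (0::real)"
  shows "0 \<le> H"
proof -
  have "\<not> X \<subseteq> {x}"
  proof
    assume "X \<subseteq> {x}"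
    have "AE y in lborel. y \<noteq> x"
      by (rule AE_lborel_singleton)
    then have "AE y in lborel. indicator X y *\<^sub>R f y = 0"
      by eventually_elim (use \<open>X \<subseteq> {x}\<close> in \<open>auto split: split_indicator\<close>)
    from integral_eq_zero_AE[OF this] show False
      using assms(2) unfolding set_lebesgue_integral_def by contradiction
  qed
  then obtain y where "y \<in> X" "y \<noteq> x" by auto
  then have "0 \<le> H * norm (x - y) powr \<nu>" "0 < norm (x - y) powr \<nu>"
    using assms(1) abs_ge_zero[of "g x - g y"] unfolding holder_at_def by (blast intro: order_trans, simp)
  then show ?thesis by (simp add: zero_le_mult_iff)
qed

text \<open>Since the window has mass 1 on \<open>X\<close>, the bias is the integral of
  \<open>(g y - g x)\<close> against the scaled kernel over \<open>X\<close>. The Hoelder bound and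
  the substitution \<open>y = x + \<theta> *\<^sub>R u\<close> produce the factor
  \<open>\<theta> powr \<nu>\<close>, while the powers \<open>\<theta> ^ CARD('r)\<close>
  cancel.\<close>

lemma kernel_bias_le:
  fixes X :: "(real ^ 'r) set"
  assumes K [measurable]: "K \<in> borel_measurable borel" and nonneg: "\<And>y. 0 \<le> K y"
    and A: "integrable lborel (\<lambda>y. norm y powr \<nu> * K y)"
    and holder: "holder_at X g x H \<nu>" and theta: "0 < \<theta>"
    and mass: "(LINT y:X|lborel. scaled_kernel K \<theta> x y) = 1"
    and int: "integrable lborel (\<lambda>y. indicator X y * g y * scaled_kernel K \<theta> x y)"
  shows "\<bar>(LINT y|lborel. indicator X y * g y * scaled_kernel K \<theta> x y) - g x\<bar>
    \<le> H * \<theta> powr \<nu> * (LINT y|lborel. norm y powr \<nu> * K y)"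
proof -
  let ?k = "scaled_kernel K \<theta> x"
  let ?h = "\<lambda>y. H * (norm (y - x) powr \<nu> * ?k y)"
  have H: "0 \<le> H" using holder_at_const_nonneg[OF holder, of ?k] mass by simp
  have k_nonneg: "0 \<le> ?k y" for y using nonneg theta by (simp add: scaled_kernel_def)
  have int_k: "integrable lborel (\<lambda>y. indicator X y * ?k y)"
    using mass by (auto simp: set_lebesgue_integral_def intro: integrable_if_integral_eq_1)
  have affine: "norm ((x + \<theta> *\<^sub>R u) - x) powr \<nu> * ?k (x + \<theta> *\<^sub>R u)
      = \<theta> powr \<nu> / \<theta> ^ CARD('r) * (norm u powr \<nu> * K u)" for u
    using theta by (simp add: scaled_kernel_affine powr_mult)
  have "integrable lborel (\<lambda>y. norm (y - x) powr \<nu> * ?k y)"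
    using A by (subst integrable_lborel_affine_iff[OF _ theta, of _ x]) (simp_all only: affine, simp_all)
  then have int_h: "integrable lborel ?h" by simp
  have h: "(LINT y|lborel. ?h y) = H * \<theta> powr \<nu> * (LINT y|lborel. norm y powr \<nu> * K y)"
    using theta by (subst integral_lborel_affine[OF _ theta, of _ x]) (simp_all only: affine, simp_all)
  have "(LINT y|lborel. indicator X y * g y * ?k y) - g x
      = (LINT y|lborel. indicator X y * g y * ?k y - g x * (indicator X y * ?k y))"
    using int int_k mass by (simp add: set_lebesgue_integral_def)
  also have "\<bar>\<dots>\<bar> \<le> (LINT y|lborel. ?h y)"
  proof (rule order_trans[OF integral_abs_bound integral_mono])
    show "integrable lborel (\<lambda>y. \<bar>indicator X y * g y * ?k y - g x * (indicator X y * ?k y)\<bar>)"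
      using int int_k by (intro integrable_abs) simp
    fix y
    have "\<bar>g x - g y\<bar> \<le> H * norm (x - y) powr \<nu>" if "y \<in> X"
      using holder that by (simp add: holder_at_def)
    then have "\<bar>g y - g x\<bar> * ?k y \<le> ?h y" if "y \<in> X"
      using that mult_right_mono[OF _ k_nonneg[of y], of "\<bar>g y - g x\<bar>" "H * norm (y - x) powr \<nu>"]
      by (simp add: abs_minus_commute norm_minus_commute mult.assoc)
    \<comment> \<open>The majorant is integrated over the whole space, so it must also dominate 0
      outside \<open>X\<close>; this is where the sign of \<open>H\<close> enters.\<close>
    moreover have "0 \<le> ?h y" using H k_nonneg[of y] by simp
    ultimately show "\<bar>indicator X y * g y * ?k y - g x * (indicator X y * ?k y)\<bar> \<le> ?h y"
      using k_nonneg[of y]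
      by (auto simp: abs_mult[symmetric] left_diff_distrib[symmetric] abs_mult split: split_indicator)
  qed (rule int_h)
  finally show ?thesis unfolding h .
qed

section \<open>The bound for the SQG-estimates\<close>

theorem theorem4:
  fixes X :: "(real ^ 'r) set"
    and g glo gup K :: "real ^ 'r \<Rightarrow> real"
    and gbar Kbar A H \<nu> \<rho> \<theta> z0 :: real
    and x :: "real ^ 'r"
    and M :: "'w measure"
    and obs :: "nat \<Rightarrow> 'w \<Rightarrow> real ^ 'r"
  assumes g_class: "g \<in> bounded_class X glo gup gbar"
    and prob: "prob_space M"
    and indep: "prob_space.indep_vars M (\<lambda>_. borel) obs UNIV"
    and dens: "\<And>t. distributed M lborel (obs t) (\<lambda>y. ennreal (indicator X y * g y))"
    and K_borel: "K \<in> borel_measurable borel"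
    and K_nonneg: "\<And>y. 0 \<le> K y"
    and K_bounded: "bounded (range K)"
    and K_density: "(LINT y|lborel. K y) = 1"
    and K_mass_X: "(LINT y:X|lborel. K y) = 1"
    and K_sup: "(SUP y\<in>X. K y) \<le> Kbar"
    and A_finite: "integrable lborel (\<lambda>y. norm y powr \<nu> * K y)"
    and A_eq: "A = (LINT y|lborel. norm y powr \<nu> * K y)"
    and x_in: "x \<in> X"
    and holder: "holder_at X g x H \<nu>"
    and rho: "0 < \<rho>" "\<rho> \<le> 1/2"
    and theta: "0 < \<theta>"
    and window_mass: "(LINT y:X|lborel. scaled_kernel K \<theta> x y) = 1"
    and z0: "z0 \<in> {glo x..gup x}"
  shows "\<exists>\<zeta> :: nat \<Rightarrow> 'w \<Rightarrow> real. \<forall>t.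
      integrable M (\<zeta> t) \<and> integrable M (\<lambda>\<omega>. (\<zeta> t \<omega>)\<^sup>2) \<and>
      prob_space.expectation M (\<zeta> t) = 0 \<and>
      prob_space.variance M (\<zeta> t) \<le> 2 * \<rho> * gbar ^ 3 * (gbar + Kbar / \<theta> ^ CARD('r)) \<and>
      (\<forall>\<omega>\<in>space M.
         (sqg K glo gup (\<lambda>_. \<rho>) (\<lambda>_. \<theta>) x z0 (\<lambda>s. obs s \<omega>) (Suc t) - g x)\<^sup>2
           \<le> 2 * gbar * A * H * \<theta> powr \<nu> + gbar\<^sup>2 * \<rho> + Kbar\<^sup>2 * \<rho> / \<theta> ^ (2 * CARD('r))
             + (1 - 2 * \<rho>) ^ t * (z0 - g x)\<^sup>2 + \<zeta> t \<omega>)"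
proof -
  interpret prob_space M by (rule prob)
  note K_borel [measurable]
  define k where "k = scaled_kernel K \<theta> x"
  define p where "p y = indicator X y * g y" for y
  define kmax where "kmax = Kbar / \<theta> ^ CARD('r)"
  define m where "m = (LINT y|lborel. p y * k y)"
  define b where "b = H * \<theta> powr \<nu> * A"
  define Z where "Z y = sqg K glo gup (\<lambda>_. \<rho>) (\<lambda>_. \<theta>) x z0 y" for y
  \<comment> \<open>\<open>C0\<close> gives a crude bound valid at every point, used for
    integrability; the sharp bound \<open>kmax\<close> will hold only almost everywhere.\<close>
  obtain C0 where C0: "\<And>y. norm (K y) \<le> C0"
    using K_bounded unfolding bounded_iff by blast
  define C where "C = C0 / \<theta> ^ CARD('r)"
  have k_borel [measurable]: "k \<in> borel_measurable borel"
    unfolding k_def by measurable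
  have k_nonneg: "0 \<le> k y" for y
    using K_nonneg theta by (simp add: k_def scaled_kernel_def)
  have k_le: "k y \<le> C" for y
    using C0[of "(1 / \<theta>) *\<^sub>R (y - x)"] theta
    by (simp add: C_def k_def scaled_kernel_def divide_right_mono)
  have g_bounds: "0 \<le> glo y" "g y \<in> {glo y..gup y}" "gup y \<le> gbar" if "y \<in> X" for y
    using g_class that by (auto simp: bounded_class_def)
  have p_nonneg: "0 \<le> p y" and p_le: "p y \<le> indicator X y * gbar" for y
    using g_bounds[of y] by (auto simp: p_def split: split_indicator)
  have dens': "distributed M lborel (obs t) (\<lambda>y. ennreal (p y))" for t
    using dens by (simp add: p_def)
  have p_borel [measurable]: "p \<in> borel_measurable borel"
    using distributed_real_measurable[OF _ dens'[of 0]] p_nonneg by simp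
  have obs_borel [measurable]: "obs t \<in> M \<rightarrow>\<^sub>M borel" for t
    using distributed_measurable[OF dens'[of t]] by simp
  have int_k: "integrable M (\<lambda>w. k (obs t w))" for t
    by (rule integrable_const_bound[where B=C]) (auto simp: k_nonneg k_le)
  have k_mean: "expectation (\<lambda>w. k (obs t w)) = m" for t
    unfolding m_def using distributed_integral[OF dens' _ p_nonneg] k_borel by simp
  have int_pk: "integrable lborel (\<lambda>y. p y * k y)"
    using distributed_integrable[OF dens'[of 0] _ p_nonneg, of k] int_k[of 0] by simp
  have bias: "\<bar>m - g x\<bar> \<le> b"
    unfolding m_def b_def A_eq p_def k_def using int_pk
    by (intro kernel_bias_le K_nonneg A_finite holder theta window_mass) (simp_all add: p_def k_def)
  have "AE y in lborel. K y \<le> Kbar"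
  proof -
    have "AE y in lborel. K y \<le> (SUP y\<in>X. K y)"
      by (rule AE_kernel_le_SUP[OF _ K_nonneg K_bounded K_density K_mass_X]) simp
    then show ?thesis by eventually_elim (use K_sup in simp)
  qed
  then have "AE u in lborel. k (x + \<theta> *\<^sub>R u) \<le> kmax"
    by eventually_elim (use theta in \<open>simp add: k_def scaled_kernel_affine kmax_def divide_right_mono\<close>)
  then have k_le_kmax: "AE y in lborel. k y \<le> kmax"
    by (intro AE_lborel_affine[where P="\<lambda>y. k y \<le> kmax" and a=x, OF _ theta]) simp_all
  \<comment> \<open>The observations have a density, so Lebesgue null sets are avoided almost
    surely; countably many times give one common null event.\<close>
  have obs_k_le: "AE w in M. \<forall>t. k (obs t w) \<le> kmax"
    unfolding AE_all_countable
  proof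
    fix t
    show "AE w in M. k (obs t w) \<le> kmax"
      using k_le_kmax by (subst distributed_AE2[OF dens']) auto
  qed
  have kmax_nonneg: "0 \<le> kmax"
  proof -
    have "AE w in M. 0 \<le> kmax"
      using obs_k_le by eventually_elim (blast intro: order_trans[OF k_nonneg])
    then show ?thesis by simp
  qed
  have gbar: "0 \<le> gbar" using g_bounds[OF x_in] by auto
  have int_Xk: "integrable lborel (\<lambda>y. indicator X y * k y)" and Xk: "(LINT y|lborel. indicator X y * k y) = 1"
    using window_mass by (auto simp: k_def set_lebesgue_integral_def intro: integrable_if_integral_eq_1)
  have int_k2: "integrable M (\<lambda>w. (k (obs t w))\<^sup>2)" for t
    by (rule integrable_const_bound[where B="C\<^sup>2"]) (auto simp: k_nonneg k_le power_mono)
  have k_second_moment: "expectation (\<lambda>w. (k (obs t w))\<^sup>2) \<le> gbar * kmax" for t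
  proof -
    have "expectation (\<lambda>w. (k (obs t w))\<^sup>2) = (LINT y|lborel. p y * (k y)\<^sup>2)"
      using distributed_integral[OF dens', of "\<lambda>y. (k y)\<^sup>2"] p_nonneg by simp
    \<comment> \<open>One factor \<open>k\<close> is bounded by \<open>kmax\<close> and
      \<open>p\<close> by \<open>gbar\<close> on \<open>X\<close>; the remaining factor
      \<open>k\<close> integrates to 1 over \<open>X\<close>.\<close>
    also have "\<dots> \<le> (LINT y|lborel. (gbar * kmax) * (indicator X y * k y))"
    proof (rule integral_mono_AE)
      show "integrable lborel (\<lambda>y. p y * (k y)\<^sup>2)"
        using distributed_integrable[OF dens'[of t] _ p_nonneg, of "\<lambda>y. (k y)\<^sup>2"] int_k2 by simp
      show "AE y in lborel. p y * (k y)\<^sup>2 \<le> (gbar * kmax) * (indicator X y * k y)"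
        using k_le_kmax
      proof eventually_elim
        case (elim y)
        have "p y * (k y)\<^sup>2 \<le> (indicator X y * gbar) * (kmax * k y)"
          unfolding power2_eq_square using elim k_nonneg[of y] gbar
          by (intro mult_mono p_le mult_right_mono) auto
        then show ?case by (simp add: mult_ac)
      qed
    qed (use int_Xk in simp)
    finally show ?thesis by (simp add: Xk)
  qed
  interpret martingale_noise M borel obs "\<lambda>y. k y - m" "\<lambda>y t. Z y t - g x" gbar "C + \<bar>m\<bar>" "gbar * kmax" \<rho>
  proof
    show "indep_vars (\<lambda>_. borel) obs UNIV" by (rule indep)
    show "(\<lambda>y. Z y s - g x) \<in> borel_measurable (PiM {..<t} (\<lambda>_. borel))" if "s \<le> t" for s t
      unfolding Z_def by (intro borel_measurable_diff borel_measurable_sqg that) simp_all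
    show "Z (restrict y {..<t}) t - g x = Z y t - g x" for y t
      unfolding Z_def by (subst sqg_cong[where y'=y]) auto
    show "\<bar>Z y t - g x\<bar> \<le> gbar" for y t
      using sqg_in_range[where glo=glo and gup=gup and x=x, OF z0, of K "\<lambda>_. \<rho>" "\<lambda>_. \<theta>" y t] g_bounds[OF x_in] by (auto simp: Z_def)
    show "\<bar>k u - m\<bar> \<le> C + \<bar>m\<bar>" for u
      using k_nonneg[of u] k_le[of u] by linarith
    show "expectation (\<lambda>w. k (obs t w) - m) = 0" for t
      using int_k[of t] by (simp add: k_mean prob_space)
    show "expectation (\<lambda>w. (k (obs t w) - m)\<^sup>2) \<le> gbar * kmax" for t
      \<comment> \<open>The variance is the second moment minus \<open>m\<^sup>2\<close>.\<close>
      using k_second_moment[of t] variance_eq[OF int_k[of t] int_k2[of t]] by (simp add: k_mean)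
         (smt (verit) zero_le_power2)
  qed (use rho in auto)
  \<comment> \<open>The index is shifted because the error at \<open>z\<close> with index
    \<open>Suc t\<close> involves the noise of the observations \<open>0\<close> to
    \<open>t\<close>.\<close>
  define W where "W t w = noise (\<lambda>s. obs s w) (Suc t)" for t w
  define L where "L t w = (Z (\<lambda>s. obs s w) (Suc t) - g x)\<^sup>2 - (2 * gbar * A * H * \<theta> powr \<nu> + gbar\<^sup>2 * \<rho>
      + Kbar\<^sup>2 * \<rho> / \<theta> ^ (2 * CARD('r)) + (1 - 2 * \<rho>) ^ t * (z0 - g x)\<^sup>2)" for t w
  text \<open>\<^term>\<open>Kbar\<close> bounds \<^term>\<open>K\<close> on \<^term>\<open>X\<close> only; on the null event that some kernel value
    exceeds \<^term>\<open>kmax\<close>, the stochastic term is raised to keep the bound.\<close>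
  define \<zeta> where "\<zeta> t w = max (W t w) (L t w)" for t w
  have W_borel [measurable]: "W t \<in> borel_measurable M" for t
    unfolding W_def by (rule noise_random_variable)
  have [measurable]: "(\<lambda>w. Z (\<lambda>s. obs s w) t) \<in> borel_measurable M" for t
    using borel_measurable_add[OF D_random_variable borel_measurable_const[of "g x"], of t] by simp
  have L_borel [measurable]: "L t \<in> borel_measurable M" for t
    unfolding L_def by measurable
  have \<zeta>_borel [measurable]: "\<zeta> t \<in> borel_measurable M" for t
    unfolding \<zeta>_def by measurable
  have L_le: "L t w \<le> W t w" if "\<forall>s. k (obs s w) \<le> kmax" for t w
  proof -
    have step: "(Z (\<lambda>s. obs s w) (Suc t) - g x)\<^sup>2 \<le> gbar * b + \<rho> / 2 * (gbar\<^sup>2 + kmax\<^sup>2)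
        + (1 - 2 * \<rho>) ^ Suc t * (z0 - g x)\<^sup>2 + W t w"
    proof -
      have "scaled_kernel K \<theta> x (obs s w) \<in> {0..kmax}" for s
        using k_nonneg[of "obs s w"] that by (simp add: k_def)
      from sqg_error_le[where glo=glo and gup=gup and x=x and y="\<lambda>s. obs s w", OF _ rho(2) g_bounds(1)[OF x_in] g_bounds(3)[OF x_in] z0 g_bounds(2)[OF x_in]
          this bias, where t="Suc t"]
      show ?thesis using rho unfolding W_def noise_def unfolding Z_def k_def by blast
    qed
    \<comment> \<open>The pathwise bound is stronger than required: its constant is half of the
      stated one, and its power of \<open>1 - 2 * \<rho>\<close> is \<open>Suc t\<close> instead of
      \<open>t\<close>.\<close>
    have "0 \<le> gbar * b + \<rho> / 2 * (gbar\<^sup>2 + kmax\<^sup>2)" using gbar bias rho by simp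
    moreover have "(1 - 2 * \<rho>) ^ Suc t * (z0 - g x)\<^sup>2 \<le> (1 - 2 * \<rho>) ^ t * (z0 - g x)\<^sup>2"
      using rho by (intro mult_right_mono power_decreasing) auto
    moreover have "2 * gbar * A * H * \<theta> powr \<nu> + gbar\<^sup>2 * \<rho> + Kbar\<^sup>2 * \<rho> / \<theta> ^ (2 * CARD('r))
        = 2 * (gbar * b + \<rho> / 2 * (gbar\<^sup>2 + kmax\<^sup>2))"
    proof -
      have "kmax\<^sup>2 = Kbar\<^sup>2 / \<theta> ^ (2 * CARD('r))"
        by (simp add: kmax_def power_divide power_mult mult.commute[of 2])
      then show ?thesis by (simp add: b_def distrib_left mult_ac)
    qed
    moreover have "a - (d + q) \<le> u" if "a \<le> c + p + u" "0 \<le> c" "p \<le> q" "d = 2 * c"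
      for a c d p q u :: real
      using that by linarith
    ultimately show ?thesis using step unfolding L_def by blast
  qed
  have \<zeta>_eq: "AE w in M. \<zeta> t w = W t w" for t
    using obs_k_le by eventually_elim (simp add: \<zeta>_def max_absorb1 L_le)
  have \<zeta>2_eq: "AE w in M. (\<zeta> t w)\<^sup>2 = (W t w)\<^sup>2" for t
    using \<zeta>_eq[of t] by eventually_elim simp
  have int_\<zeta>: "integrable M (\<zeta> t)" for t
    using integrable_noise[of "Suc t"] integrable_cong_AE[OF _ _ \<zeta>_eq[of t]] by (simp add: W_def)
  have int_\<zeta>2: "integrable M (\<lambda>w. (\<zeta> t w)\<^sup>2)" for t
    using integrable_noise_squared[of "Suc t"] integrable_cong_AE[OF _ _ \<zeta>2_eq[of t]] by (simp add: W_def)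
  have mean: "expectation (\<zeta> t) = 0" for t
    using expectation_noise[of "Suc t"] integral_cong_AE[OF _ _ \<zeta>_eq[of t]] by (simp add: W_def)
  have var: "variance (\<zeta> t) \<le> 2 * \<rho> * gbar ^ 3 * (gbar + Kbar / \<theta> ^ CARD('r))" for t
  proof -
    have "variance (\<zeta> t) = expectation (\<lambda>w. (W t w)\<^sup>2)"
      using integral_cong_AE[OF _ _ \<zeta>2_eq[of t]] by (simp add: mean)
    also have "\<dots> \<le> 2 * \<rho> * gbar\<^sup>2 * (gbar * kmax)"
      unfolding W_def by (rule expectation_noise_squared)
    also have "\<dots> = 2 * \<rho> * gbar ^ 3 * kmax"
      by (simp add: power2_eq_square power3_eq_cube)
    \<comment> \<open>The second moment bound has only \<open>kmax\<close> as last factor; adding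
      the nonnegative \<open>gbar\<close> gives the stated form.\<close>
    also have "\<dots> \<le> 2 * \<rho> * gbar ^ 3 * (gbar + kmax)"
      using rho gbar by (intro mult_left_mono) auto
    finally show ?thesis by (simp add: kmax_def)
  qed
  have "(sqg K glo gup (\<lambda>_. \<rho>) (\<lambda>_. \<theta>) x z0 (\<lambda>s. obs s w) (Suc t) - g x)\<^sup>2
      \<le> 2 * gbar * A * H * \<theta> powr \<nu> + gbar\<^sup>2 * \<rho> + Kbar\<^sup>2 * \<rho> / \<theta> ^ (2 * CARD('r))
        + (1 - 2 * \<rho>) ^ t * (z0 - g x)\<^sup>2 + \<zeta> t w" for t w
  proof -
    have "L t w \<le> \<zeta> t w" by (simp add: \<zeta>_def)
    then show ?thesis unfolding L_def Z_def by linarith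
  qed
  with int_\<zeta> int_\<zeta>2 mean var show ?thesis by blast
qed

end
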